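(* For every integer $n\ge 0$, every $\mathbf x=(x_1,\dots,x_n)\in[0,\infty)^n$, and every $k=0,\ldots,n$, $$K_n(\mathbf x)\,e_k(\mathbf x)\le\binom nk .$$ Equivalently, $K_n(\mathbf x)A_k(\mathbf x)\le 1$ for every $k\in\{0,\dots,n\}$.
   Context: For $n\ge1$ and $\mathbf x\in[0,\infty)^n$, $K_n(\mathbf x)=\mathbb P\{\sum_{i=1}^n x_iD_i\le 1\}$, where $(D_0,D_1,\ldots,D_n)$ has the Dirichlet distribution with all $n+1$ parameters equal to $1$ (uniform on the probability simplex with $n+1$ coordinates; $D_0$ does not appear in the sum). By convention $K_0=1$. The elementary symmetric polynomials are $e_k(\mathbf x)=\sum_{S\subseteq\{1,\dots,n\},\,|S|=k}\prod_{i\in S}x_i$ with $e_0=1$, and $A_k(\mathbf x)=e_k(\mathbf x)/\binom nk$. *)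

theory Defs
  imports "HOL-Probability.Probability"
begin

(* The Dirichlet distribution of (D_0, ..., D_n) with parameters a 0, ..., a n > 0. It is singular
   with respect to Lebesgue measure on R^(n+1), so it is given as the law of
   (1 - (d_1 + ... + d_n), d_1, ..., d_n), where (d_1, ..., d_n) has the usual density on the
   interior of the solid simplex. *)

definition dirichlet_density :: "nat \<Rightarrow> (nat \<Rightarrow> real) \<Rightarrow> (nat \<Rightarrow> real) \<Rightarrow> real" where
  "dirichlet_density n a d =
     (if (\<forall>i\<in>{1..n}. 0 < d i) \<and> (\<Sum>i=1..n. d i) < 1
      then Gamma (\<Sum>i=0..n. a i) / (\<Prod>i=0..n. Gamma (a i))
             * (1 - (\<Sum>i=1..n. d i)) powr (a 0 - 1) * (\<Prod>i=1..n. d i powr (a i - 1))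
      else 0)"

definition dirichlet :: "nat \<Rightarrow> (nat \<Rightarrow> real) \<Rightarrow> (nat \<Rightarrow> real) measure" where
  "dirichlet n a =
     distr (density (\<Pi>\<^sub>M i\<in>{1..n}. lborel) (\<lambda>d. ennreal (dirichlet_density n a d)))
       (\<Pi>\<^sub>M i\<in>{0..n}. borel)
       (\<lambda>d. \<lambda>i\<in>{0..n}. if i = 0 then 1 - (\<Sum>j=1..n. d j) else d i)"

lemma dirichlet_density_measurable [measurable]:
  "dirichlet_density n a \<in> borel_measurable (\<Pi>\<^sub>M i\<in>{1..n}. lborel)"
  unfolding dirichlet_density_def by measurable

lemma dirichlet_map_measurable [measurable]:
  fixes n :: nat
  shows "(\<lambda>d. \<lambda>i\<in>{0..n}. if i = 0 then 1 - (\<Sum>j=1..n. d j) else d i)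
     \<in> (\<Pi>\<^sub>M i\<in>{1..n}. lborel) \<rightarrow>\<^sub>M (\<Pi>\<^sub>M i\<in>{0..n}. borel :: real measure)"
proof (rule measurable_restrict)
  fix i assume "i \<in> {0..n}"
  show "(\<lambda>d. if i = 0 then 1 - (\<Sum>j=1..n. d j) else d i)
          \<in> (\<Pi>\<^sub>M i\<in>{1..n}. lborel) \<rightarrow>\<^sub>M (borel :: real measure)"
  proof (cases "i = 0")
    case True
    then show ?thesis by simp
  next
    case False
    with \<open>i \<in> {0..n}\<close> have i: "i \<in> {1..n}" by simp
    have "(\<lambda>d. d i) \<in> (\<Pi>\<^sub>M i\<in>{1..n}. lborel) \<rightarrow>\<^sub>M (lborel :: real measure)"
      by (rule measurable_component_singleton[OF i])
    with False show ?thesis by simp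
  qed
qed

definition open_simplex :: "nat \<Rightarrow> (nat \<Rightarrow> real) set" where
  "open_simplex n = {d \<in> {1..n} \<rightarrow>\<^sub>E UNIV. (\<forall>i\<in>{1..n}. 0 < d i) \<and> (\<Sum>i=1..n. d i) < 1}"

lemma open_simplex_sets [measurable]: "open_simplex n \<in> sets (\<Pi>\<^sub>M i\<in>{1..n}. lborel)"
proof -
  have "{d \<in> space (\<Pi>\<^sub>M i\<in>{1..n}. lborel :: real measure).
          (\<forall>i\<in>{1..n}. 0 < d i) \<and> (\<Sum>i=1..n. d i) < 1} \<in> sets (\<Pi>\<^sub>M i\<in>{1..n}. lborel)"
    by measurable
  then show ?thesis
    by (simp add: open_simplex_def space_PiM)
qed

lemma dirichlet_density_one:
  assumes "d \<in> space (\<Pi>\<^sub>M i\<in>{1..n}. lborel)"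
  shows "ennreal (dirichlet_density n (\<lambda>_. 1) d) = fact n * indicator (open_simplex n) d"
proof (cases "d \<in> open_simplex n")
  case True
  then have d: "\<forall>i\<in>{1..n}. 0 < d i" "(\<Sum>i=1..n. d i) < 1"
    by (simp_all add: open_simplex_def)
  from d(1) have "(\<Prod>i=1..n. d i powr (1 - 1)) = 1"
    by (intro prod.neutral) auto
  moreover have "Gamma (\<Sum>i=0..n. 1 :: real) = fact n"
    using Gamma_fact[of n, where 'a = real] by (simp add: add.commute)
  ultimately show ?thesis
    using d True by (simp add: dirichlet_density_def ennreal_fact del: One_nat_def)
next
  case False
  with assms show ?thesis
    by (auto simp: dirichlet_density_def open_simplex_def space_PiM simp del: One_nat_def)
qed

lemma emeasure_open_simplex:
  "emeasure (\<Pi>\<^sub>M i\<in>{1..n}. lborel) (open_simplex n) = ennreal (1 / fact n)"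
proof (rule antisym)
  let ?M = "\<Pi>\<^sub>M i\<in>{1..n}. lborel :: real measure"
  let ?S = "\<lambda>t. {d. (\<forall>i\<in>{1..n}. 0 \<le> d i) \<and> sum d {1..n} \<le> t} \<inter> space ?M"
  have S_meas [measurable]: "?S t \<in> sets ?M" for t
  proof -
    have "{d \<in> space ?M. (\<forall>i\<in>{1..n}. 0 \<le> d i) \<and> (\<Sum>i=1..n. d i) \<le> t} \<in> sets ?M"
      by measurable
    then show ?thesis by (simp add: Int_def conj_commute)
  qed
  have S: "emeasure ?M (?S t) = ennreal (t ^ n / fact n)" if "0 \<le> t" for t
    using emeasure_std_simplex_aux[of "{1..n}" t] that by simp
  have "emeasure ?M (open_simplex n) \<le> emeasure ?M (?S 1)"
    by (intro emeasure_mono S_meas) (auto simp: open_simplex_def space_PiM less_imp_le)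
  then show "emeasure ?M (open_simplex n) \<le> ennreal (1 / fact n)"
    using S[of 1] by simp
  interpret product_sigma_finite "\<lambda>_. lborel :: real measure" ..
  define Z where "Z i = (\<Pi>\<^sub>E j\<in>{1..n}. if j = i then {0} else UNIV :: real set)" for i
  have Z: "Z i \<in> null_sets ?M" if "i \<in> {1..n}" for i
  proof (rule null_setsI)
    have "emeasure ?M (Z i) = (\<Prod>j=1..n. emeasure lborel (if j = i then {0} else UNIV :: real set))"
      unfolding Z_def by (rule emeasure_PiM) auto
    also have "\<dots> = 0"
      using that by (auto intro!: prod_zero bexI[of _ i])
    finally show "emeasure ?M (Z i) = 0" .
    show "Z i \<in> sets ?M"
      unfolding Z_def by (rule sets_PiM_I_finite) auto
  qed
  have ZU: "(\<Union>i\<in>{1..n}. Z i) \<in> null_sets ?M"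
    by (intro null_sets.finite_UN) (use Z in auto)
  have le: "ennreal (t ^ n / fact n) \<le> emeasure ?M (open_simplex n)" if "0 < t" "t < 1" for t
  proof -
    have sub: "?S t \<subseteq> open_simplex n \<union> (\<Union>i\<in>{1..n}. Z i)"
    proof
      fix d assume d: "d \<in> ?S t"
      show "d \<in> open_simplex n \<union> (\<Union>i\<in>{1..n}. Z i)"
      proof (cases "\<exists>i\<in>{1..n}. d i = 0")
        case True
        then obtain i where i: "i \<in> {1..n}" "d i = 0" by blast
        have "d \<in> Z i" using d i by (auto simp: Z_def space_PiM PiE_iff)
        with i show ?thesis by blast
      next
        case False
        then have "d i > 0" if "i \<in> {1..n}" for i
          using d that by (metis (mono_tags, lifting) IntD1 mem_Collect_eq order_less_le)
        moreover have "sum d {1..n} < 1" using d that by auto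
        ultimately show ?thesis using d by (auto simp: open_simplex_def space_PiM)
      qed
    qed
    have "emeasure ?M (?S t) \<le> emeasure ?M (open_simplex n \<union> (\<Union>i\<in>{1..n}. Z i))"
      by (rule emeasure_mono[OF sub]) (use ZU null_setsD2[OF ZU] open_simplex_sets in blast)
    also have "\<dots> = emeasure ?M (open_simplex n)"
      by (rule emeasure_Un_null_set[OF open_simplex_sets ZU])
    finally show ?thesis using S that by simp
  qed
  have "((\<lambda>t. ennreal (t ^ n / fact n)) \<longlongrightarrow> ennreal (1 ^ n / fact n)) (at_left 1)"
    by (intro tendsto_ennrealI tendsto_intros) simp
  moreover have "\<forall>\<^sub>F t in at_left 1. ennreal (t ^ n / fact n) \<le> emeasure ?M (open_simplex n)"
    by (rule eventually_mono[OF eventually_at_left_real[of 0 1]]) (auto intro: le simp del: One_nat_def)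
  ultimately show "ennreal (1 / fact n) \<le> emeasure ?M (open_simplex n)"
    using tendsto_upperbound[of _ "ennreal (1 ^ n / fact n)" "at_left (1::real)"] by fastforce
qed

lemma dirichlet_one_eq_uniform:
  "dirichlet n (\<lambda>_. 1) =
     distr (uniform_measure (\<Pi>\<^sub>M i\<in>{1..n}. lborel) (open_simplex n)) (\<Pi>\<^sub>M i\<in>{0..n}. borel)
       (\<lambda>d. \<lambda>i\<in>{0..n}. if i = 0 then 1 - (\<Sum>j=1..n. d j) else d i)"
proof -
  have "1 / ennreal (1 / fact n) = fact n"
    by (simp add: divide_ennreal ennreal_fact flip: ennreal_1)
  then have "density (\<Pi>\<^sub>M i\<in>{1..n}. lborel) (\<lambda>d. ennreal (dirichlet_density n (\<lambda>_. 1) d))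
      = uniform_measure (\<Pi>\<^sub>M i\<in>{1..n}. lborel) (open_simplex n)"
    unfolding uniform_measure_def
    by (intro density_cong AE_I2)
       (auto simp: dirichlet_density_one emeasure_open_simplex split: split_indicator
             simp del: One_nat_def)
  then show ?thesis by (simp add: dirichlet_def del: One_nat_def)
qed

lemma prob_space_dirichlet_one: "prob_space (dirichlet n (\<lambda>_. 1))"
proof -
  interpret U: prob_space "uniform_measure (\<Pi>\<^sub>M i\<in>{1..n}. lborel) (open_simplex n)"
    by (rule prob_space_uniform_measure) (simp_all add: emeasure_open_simplex del: One_nat_def)
  show ?thesis
    unfolding dirichlet_one_eq_uniform by (rule U.prob_space_distr)
      (subst measurable_cong_sets[OF sets_uniform_measure refl], rule dirichlet_map_measurable)
qed

definition K :: "nat \<Rightarrow> (nat \<Rightarrow> real) \<Rightarrow> real" where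
  "K n x = (if n = 0 then 1 else \<P>(D in dirichlet n (\<lambda>_. 1). (\<Sum>i=1..n. x i * D i) \<le> 1))"

definition elem_sym :: "nat \<Rightarrow> nat \<Rightarrow> (nat \<Rightarrow> real) \<Rightarrow> real" where
  "elem_sym n k x = (\<Sum>S\<in>{S. S \<subseteq> {1..n} \<and> card S = k}. \<Prod>i\<in>S. x i)"

definition elem_sym_mean :: "nat \<Rightarrow> nat \<Rightarrow> (nat \<Rightarrow> real) \<Rightarrow> real" where
  "elem_sym_mean n k x = elem_sym n k x / real (n choose k)"

end

theory Submission
  imports Defs
begin

text \<open>
  Up to the factor \<open>n!\<close>, the number \<open>K n x\<close> is the volume of the polytope cut out of the positive
  orthant by the two inequalities \<open>\<Sum> d\<^sub>i \<le> 1\<close> and \<open>\<Sum> x\<^sub>i d\<^sub>i \<le> 1\<close>.  The facet \<open>d\<^sub>i = 0\<close> of this polytope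
  is the polytope of the same kind belonging to the vector \<open>x\<close> with its \<open>i\<close>-th entry deleted.

  Suppose that \<open>x\<^sub>i > 1 > x\<^sub>j\<close>.  On the segment between the \<open>i\<close>-th and the \<open>j\<close>-th unit vector there is
  then a vertex \<open>p\<close> of the polytope at which both inequalities are equalities: \<open>p\<^sub>i + p\<^sub>j = 1\<close> and
  \<open>p\<^sub>i x\<^sub>i + p\<^sub>j x\<^sub>j = 1\<close>.  The only facets that avoid \<open>p\<close> are \<open>d\<^sub>i = 0\<close> and \<open>d\<^sub>j = 0\<close>, so the polytope is
  the union of the two cones with apex \<open>p\<close> over these facets, of heights \<open>p\<^sub>i\<close> and \<open>p\<^sub>j\<close>.  In normalised
  volumes, \<open>K(x) = p\<^sub>i K(x - x\<^sub>i) + p\<^sub>j K(x - x\<^sub>j)\<close>, where \<open>x - x\<^sub>i\<close> denotes deletion of an entry.  If no such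
  pair exists, one of the two inequalities is redundant, and a single cone does the same job.  In all
  cases there are weights \<open>p\<^sub>i \<ge> 0\<close> with \<open>\<Sum> p\<^sub>i \<le> 1\<close>, \<open>\<Sum> p\<^sub>i x\<^sub>i \<le> 1\<close> and \<open>K(x) \<le> \<Sum> p\<^sub>i K(x - x\<^sub>i)\<close>
  (lemma \<open>cut_prob_le_deletions\<close>).

  These weights fit the recursion \<open>e\<^sub>k(x) = e\<^sub>k(x - x\<^sub>i) + x\<^sub>i e\<^bsub>k-1\<^esub>(x - x\<^sub>i)\<close> exactly.  By induction
  on the number \<open>n\<close> of entries,
  \<open>K(x) e\<^sub>k(x) \<le> \<Sum> p\<^sub>i (C(n-1,k) + x\<^sub>i C(n-1,k-1)) \<le> C(n-1,k) + C(n-1,k-1) = C(n,k)\<close>,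
  which is lemma \<open>cut_prob_esym_le\<close>.
\<close>

section \<open>The volume of a simplex cut by a half-space\<close>

text \<open>
  Index sets are arbitrary, because the induction deletes arbitrary coordinates.  The two bounds are
  kept as separate parameters: fixing one coordinate at \<open>t\<close> lowers them by the different amounts \<open>t\<close>
  and \<open>x m * t\<close>.
\<close>

definition cut_simplex :: "'i set \<Rightarrow> ('i \<Rightarrow> real) \<Rightarrow> real \<Rightarrow> real \<Rightarrow> ('i \<Rightarrow> real) set" where
  "cut_simplex I x a b =
     {d \<in> space (\<Pi>\<^sub>M i\<in>I. lborel). (\<forall>i\<in>I. 0 \<le> d i) \<and> (\<Sum>i\<in>I. d i) \<le> a \<and> (\<Sum>i\<in>I. x i * d i) \<le> b}"

definition cut_volume :: "'i set \<Rightarrow> ('i \<Rightarrow> real) \<Rightarrow> real \<Rightarrow> real \<Rightarrow> ennreal" where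
  "cut_volume I x a b = emeasure (\<Pi>\<^sub>M i\<in>I. lborel) (cut_simplex I x a b)"

lemma cut_simplex_sets [measurable]:
  "finite I \<Longrightarrow> cut_simplex I x a b \<in> sets (\<Pi>\<^sub>M i\<in>I. lborel)"
  unfolding cut_simplex_def by measurable

lemma cut_volume_eq_0:
  assumes "a < 0"
  shows "cut_volume I x a b = 0"
proof -
  have "cut_simplex I x a b = {}"
    using assms sum_nonneg[of I] by (fastforce simp: cut_simplex_def)
  then show ?thesis by (simp add: cut_volume_def)
qed

lemma cut_volume_empty: "cut_volume {} x 1 1 = 1"
proof -
  have "cut_simplex {} x 1 1 = {\<lambda>_. undefined}"
    by (auto simp: cut_simplex_def space_PiM)
  then show ?thesis by (simp add: cut_volume_def PiM_empty)
qed

text \<open>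
  The volume is that of the section at \<open>z\<close> of one measurable subset of a product space.
\<close>

lemma borel_measurable_cut_volume:
  assumes I: "finite I" and [measurable]: "f \<in> borel_measurable M" "g \<in> borel_measurable M"
  shows "(\<lambda>z. cut_volume I x (f z) (g z)) \<in> borel_measurable M"
proof -
  interpret product_sigma_finite "\<lambda>_. lborel :: real measure" ..
  interpret finite_product_sigma_finite "\<lambda>_. lborel :: real measure" I
    by standard (rule I)
  let ?P = "\<Pi>\<^sub>M i\<in>I. lborel :: real measure"
  note I[measurable]
  define A where "A = {w \<in> space (M \<Otimes>\<^sub>M ?P). (\<forall>i\<in>I. 0 \<le> snd w i) \<and>
      (\<Sum>i\<in>I. snd w i) \<le> f (fst w) \<and> (\<Sum>i\<in>I. x i * snd w i) \<le> g (fst w)}"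
  have A: "A \<in> sets (M \<Otimes>\<^sub>M ?P)"
    unfolding A_def by measurable
  have "(\<lambda>z. emeasure ?P (Pair z -` A)) \<in> borel_measurable M"
    by (rule measurable_emeasure_Pair[OF A])
  moreover have "Pair z -` A = cut_simplex I x (f z) (g z)" if "z \<in> space M" for z
    using that by (auto simp: A_def cut_simplex_def space_pair_measure)
  ultimately show ?thesis
    unfolding cut_volume_def by (simp cong: measurable_cong)
qed

text \<open>
  Slicing along the coordinate \<open>m\<close>: the recursion on which all volume computations below rest.
\<close>

lemma cut_volume_insert:
  assumes I: "finite I" and m: "m \<notin> I"
  shows "cut_volume (insert m I) x a b =
     (\<integral>\<^sup>+t. indicator {0..} t * cut_volume I x (a - t) (b - x m * t) \<partial>lborel)"
proof -
  interpret product_sigma_finite "\<lambda>_. lborel :: real measure" ..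
  let ?P = "\<lambda>I. \<Pi>\<^sub>M i\<in>I. lborel :: real measure"
  have upd: "indicator (cut_simplex (insert m I) x a b) (d(m := t)) =
      (indicator {0..} t * indicator (cut_simplex I x (a - t) (b - x m * t)) d :: ennreal)"
    if d: "d \<in> space (?P I)" for d t
  proof -
    have "(\<Sum>i\<in>I. (d(m := t)) i) = (\<Sum>i\<in>I. d i)" "(\<Sum>i\<in>I. x i * (d(m := t)) i) = (\<Sum>i\<in>I. x i * d i)"
      "(\<forall>i\<in>I. 0 \<le> (d(m := t)) i) \<longleftrightarrow> (\<forall>i\<in>I. 0 \<le> d i)"
      using m by (auto intro!: sum.cong)
    moreover have "d(m := t) \<in> space (?P (insert m I))"
      using d by (auto simp: space_PiM PiE_iff extensional_def)
    ultimately have "d(m := t) \<in> cut_simplex (insert m I) x a b \<longleftrightarrow>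
        0 \<le> t \<and> d \<in> cut_simplex I x (a - t) (b - x m * t)"
      using d I m by (auto simp: cut_simplex_def algebra_simps)
    then show ?thesis by (simp split: split_indicator)
  qed
  have "cut_volume (insert m I) x a b =
      (\<integral>\<^sup>+d. indicator (cut_simplex (insert m I) x a b) d \<partial>?P (insert m I))"
    using I by (simp add: cut_volume_def)
  also have "\<dots> = (\<integral>\<^sup>+t. \<integral>\<^sup>+d. indicator (cut_simplex (insert m I) x a b) (d(m := t)) \<partial>?P I \<partial>lborel)"
    using I m by (intro product_nn_integral_insert_rev) auto
  also have "\<dots> = (\<integral>\<^sup>+t. \<integral>\<^sup>+d. indicator {0..} t * indicator (cut_simplex I x (a - t) (b - x m * t)) d \<partial>?P I \<partial>lborel)"
    by (intro nn_integral_cong upd) auto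
  also have "\<dots> = (\<integral>\<^sup>+t. indicator {0..} t * cut_volume I x (a - t) (b - x m * t) \<partial>lborel)"
    unfolding cut_volume_def using I by (intro nn_integral_cong) (simp add: nn_integral_cmult)
  finally show ?thesis .
qed

lemma cut_volume_scale:
  assumes "finite I" "0 < s"
  shows "cut_volume I x (s * a) (s * b) = ennreal (s ^ card I) * cut_volume I x a b"
  using assms(1)
proof (induction I arbitrary: a b)
  case empty
  have "cut_simplex {} x (s * a) (s * b) = cut_simplex {} x a b"
    using \<open>0 < s\<close> by (auto simp: cut_simplex_def zero_le_mult_iff)
  then show ?case by (simp add: cut_volume_def)
next
  case (insert m I)
  note [measurable] = borel_measurable_cut_volume[OF insert.hyps(1)]
  have "cut_volume (insert m I) x (s * a) (s * b) =
      ennreal s * (\<integral>\<^sup>+t. indicator {0..} (0 + s * t) *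
        cut_volume I x (s * a - (0 + s * t)) (s * b - x m * (0 + s * t)) \<partial>lborel)"
    unfolding cut_volume_insert[OF insert.hyps(1,2)]
    using \<open>0 < s\<close> by (subst nn_integral_real_affine[where c = s and t = 0]) auto
  also have "\<dots> = ennreal s * (\<integral>\<^sup>+t. ennreal (s ^ card I) *
        (indicator {0..} t * cut_volume I x (a - t) (b - x m * t)) \<partial>lborel)"
  proof (intro arg_cong[where f = "\<lambda>z. ennreal s * z"] nn_integral_cong)
    fix t
    have "cut_volume I x (s * a - (0 + s * t)) (s * b - x m * (0 + s * t)) =
        cut_volume I x (s * (a - t)) (s * (b - x m * t))"
      by (simp add: algebra_simps)
    then show "indicator {0..} (0 + s * t) *
        cut_volume I x (s * a - (0 + s * t)) (s * b - x m * (0 + s * t)) =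
      ennreal (s ^ card I) * (indicator {0..} t * cut_volume I x (a - t) (b - x m * t))"
      using \<open>0 < s\<close> by (simp add: insert.IH zero_le_mult_iff mult.left_commute split: split_indicator)
  qed
  also have "\<dots> = ennreal s * (ennreal (s ^ card I) * cut_volume (insert m I) x a b)"
    by (subst nn_integral_cmult) (auto simp: cut_volume_insert[OF insert.hyps(1,2)])
  finally show ?case
    using insert.hyps \<open>0 < s\<close> by (simp add: ennreal_mult mult.assoc)
qed

section \<open>Volumes of cones\<close>

lemma nn_integral_one_minus_power:
  fixes c :: real
  assumes "0 < c"
  shows "(\<integral>\<^sup>+t. ennreal ((1 - c * t) ^ n) * indicator {0..1 / c} t \<partial>lborel) = ennreal (1 / (c * (real n + 1)))"
proof -
  have nz: "c * (real n + 1) \<noteq> 0" using assms by simp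
  define F where "F t = - ((1 - c * t) ^ Suc n) / (c * (real n + 1))" for t
  have "(\<integral>\<^sup>+t. ennreal ((1 - c * t) ^ n) * indicator {0..1 / c} t \<partial>lborel) = ennreal (F (1 / c) - F 0)"
  proof (rule nn_integral_FTC_Icc)
    show "(F has_real_derivative (1 - c * t) ^ n) (at t)" for t
    proof -
      have "((\<lambda>t. (1 - c * t) ^ Suc n) has_real_derivative (real n + 1) * (- c) * (1 - c * t) ^ n) (at t)"
        by (auto intro!: derivative_eq_intros simp del: power_Suc simp: algebra_simps)
      from DERIV_cdivide[OF DERIV_minus[OF this], of "c * (real n + 1)"]
      have "(F has_real_derivative - ((real n + 1) * (- c) * (1 - c * t) ^ n) / (c * (real n + 1))) (at t)"
        unfolding F_def .
      also have "- ((real n + 1) * (- c) * (1 - c * t) ^ n) = c * (real n + 1) * (1 - c * t) ^ n"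
        by simp
      also have "c * (real n + 1) * (1 - c * t) ^ n / (c * (real n + 1)) = (1 - c * t) ^ n"
        using nz by (rule nonzero_mult_div_cancel_left)
      finally show ?thesis .
    qed
    show "0 \<le> (1 - c * t) ^ n" if "t \<in> {0..1 / c}" for t
      using that assms by (intro zero_le_power) (simp add: field_simps)
  qed (use assms in auto)
  also have "F (1 / c) - F 0 = 1 / (c * (real n + 1))"
    using assms by (simp add: F_def)
  finally show ?thesis .
qed

text \<open>
  The sections of a cone parallel to its base are scaled copies of the base, here the cut simplex over
  \<open>I\<close>, and they shrink to a point at the height \<open>1 / c\<close>.  So this is the familiar formula base times height
  divided by dimension for a cone of dimension \<open>card I + 1\<close>.
\<close>

lemma nn_integral_cone:
  assumes I: "finite I" and c: "0 < c"
  shows "(\<integral>\<^sup>+t. indicator {0..} t * cut_volume I x (1 - c * t) (1 - c * t) \<partial>lborel) =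
     ennreal (1 / (c * (real (card I) + 1))) * cut_volume I x 1 1"
proof -
  have "(\<integral>\<^sup>+t. indicator {0..} t * cut_volume I x (1 - c * t) (1 - c * t) \<partial>lborel) =
      (\<integral>\<^sup>+t. (ennreal ((1 - c * t) ^ card I) * indicator {0..1 / c} t) * cut_volume I x 1 1 \<partial>lborel)"
  \<comment> \<open>At the apex \<open>t = 1 / c\<close> the bounds are both zero and scaling says nothing; it is a null set.\<close>
  proof (rule nn_integral_cong_AE, rule eventually_mono[OF AE_lborel_singleton[of "1 / c"]])
    fix t :: real assume t: "t \<noteq> 1 / c"
    show "indicator {0..} t * cut_volume I x (1 - c * t) (1 - c * t) =
       ennreal ((1 - c * t) ^ card I) * indicator {0..1 / c} t * cut_volume I x 1 1"
    proof (cases "c * t < 1")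
      case True
      then have "t \<le> 1 / c" using c by (simp add: field_simps)
      with cut_volume_scale[OF I, of "1 - c * t" x 1 1] True show ?thesis
        by (simp split: split_indicator)
    next
      case False
      moreover have "c * t \<noteq> 1" using t c by (auto simp: field_simps)
      ultimately have "1 - c * t < 0" by simp
      moreover from this have "t > 1 / c" using c by (simp add: field_simps)
      ultimately show ?thesis by (simp add: cut_volume_eq_0)
    qed
  qed
  also have "\<dots> = ennreal (1 / (c * (real (card I) + 1))) * cut_volume I x 1 1"
    by (subst nn_integral_multc) (auto simp: nn_integral_one_minus_power[OF c])
  finally show ?thesis .
qed

text \<open>
  Write \<open>u\<close>, \<open>v\<close> for the coordinates \<open>i\<close>, \<open>j\<close> and let \<open>P\<close> be the point with these two coordinates \<open>p\<close>, \<open>q\<close>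
  and all others zero.  The points of the cut simplex with \<open>p v \<ge> q u\<close> are those that lie on segments from \<open>P\<close>
  to the facet \<open>u = 0\<close>.  Shearing along \<open>v\<close> makes the slice at \<open>u\<close> the facet scaled by \<open>1 - u / p\<close>, since
  moving towards \<open>P\<close> uses up both bounds at the same rate; the apex is reached at the height \<open>p\<close>.
\<close>

lemma nn_integral_wedge:
  fixes x :: "'i \<Rightarrow> real"
  assumes R: "finite R" and j: "j \<notin> R"
    and p: "0 < p" and sum_p: "p + q = 1" and sum_px: "p * x i + q * x j = 1"
  shows "(\<integral>\<^sup>+u. indicator {0..} u * (\<integral>\<^sup>+v. indicator {q / p * u..} v *
            cut_volume R x (1 - u - v) (1 - x i * u - x j * v) \<partial>lborel) \<partial>lborel) =
         ennreal (p / (real (card R) + 2)) * cut_volume (insert j R) x 1 1"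
proof -
  note [measurable] = borel_measurable_cut_volume[OF R]
  have inner: "(\<integral>\<^sup>+v. indicator {q / p * u..} v * cut_volume R x (1 - u - v) (1 - x i * u - x j * v) \<partial>lborel) =
      cut_volume (insert j R) x (1 - (1 / p) * u) (1 - (1 / p) * u)" for u
  proof -
    \<comment> \<open>Both bounds are used up at the rate \<open>1 / p\<close> along the line from the origin to \<open>P\<close>.\<close>
    have eq: "1 - u - q / p * u = 1 - (1 / p) * u"
         "1 - x i * u - x j * (q / p * u) = 1 - (1 / p) * u"
    proof -
      have "u + q / p * u = (p + q) * (u / p)" "x i * u + x j * (q / p * u) = (p * x i + q * x j) * (u / p)"
        using p by (simp_all add: field_simps)
      then show "1 - u - q / p * u = 1 - (1 / p) * u"
         "1 - x i * u - x j * (q / p * u) = 1 - (1 / p) * u"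
        unfolding sum_p sum_px by simp_all
    qed
    have "(\<integral>\<^sup>+v. indicator {q / p * u..} v * cut_volume R x (1 - u - v) (1 - x i * u - x j * v) \<partial>lborel) =
       (\<integral>\<^sup>+v. indicator {q / p * u..} (q / p * u + 1 * v) *
          cut_volume R x (1 - u - (q / p * u + 1 * v)) (1 - x i * u - x j * (q / p * u + 1 * v)) \<partial>lborel)"
      by (subst nn_integral_real_affine[where c = 1 and t = "q / p * u"]) auto
    also have "\<dots> = (\<integral>\<^sup>+v. indicator {0..} v *
          cut_volume R x (1 - (1 / p) * u - v) (1 - (1 / p) * u - x j * v) \<partial>lborel)"
    proof (rule nn_integral_cong)
      fix v
      have "1 - u - (q / p * u + 1 * v) = 1 - (1 / p) * u - v"
        "1 - x i * u - x j * (q / p * u + 1 * v) = 1 - (1 / p) * u - x j * v"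
        using eq by (simp_all only: distrib_left)
      then show "indicator {q / p * u..} (q / p * u + 1 * v) *
          cut_volume R x (1 - u - (q / p * u + 1 * v)) (1 - x i * u - x j * (q / p * u + 1 * v)) =
          indicator {0..} v * cut_volume R x (1 - (1 / p) * u - v) (1 - (1 / p) * u - x j * v)"
        by (simp only:) (simp split: split_indicator)
    qed
    finally show ?thesis by (simp only: cut_volume_insert[OF R j])
  qed
  have "1 / ((1 / p) * (real (card (insert j R)) + 1)) = p / (real (card R) + 2)"
    using R j p by simp
  then show ?thesis
    unfolding inner using nn_integral_cone[of "insert j R" "1 / p" x] R p by (simp add: add.commute)
qed

text \<open>
  The two wedges \<open>p v \<ge> q u\<close> and \<open>q u \<ge> p v\<close> cover the cut simplex, and the roles of \<open>i\<close> and \<open>j\<close> are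
  exchanged between them.
\<close>

lemma cut_volume_two_cones:
  fixes x :: "'i \<Rightarrow> real"
  assumes R: "finite R" and ij: "i \<notin> R" "j \<notin> R" "i \<noteq> j"
    and p: "0 < p" "0 < q" "p + q = 1" "p * x i + q * x j = 1"
  shows "cut_volume (insert i (insert j R)) x 1 1 \<le>
     ennreal (p / (real (card R) + 2)) * cut_volume (insert j R) x 1 1 +
     ennreal (q / (real (card R) + 2)) * cut_volume (insert i R) x 1 1"
proof -
  note [measurable] = borel_measurable_cut_volume[OF R]
  define w where "w u v = cut_volume R x (1 - u - v) (1 - x i * u - x j * v)" for u v
  define f where "f u v = indicator {0..} u * (indicator {q / p * u..} v * w u v)" for u v
  define g where "g u v = indicator {0..} v * (indicator {p / q * v..} u * w u v)" for u v
  have w_measurable [measurable]: "w u \<in> borel_measurable borel" "(\<lambda>u. w u v) \<in> borel_measurable borel" for u v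
    unfolding w_def by measurable
  have f_pair: "case_prod f \<in> borel_measurable (lborel \<Otimes>\<^sub>M lborel)"
  proof -
    have "case_prod f = (\<lambda>z. indicator {0..} (fst z) *
        (indicator {z. q / p * fst z \<le> snd z} z * w (fst z) (snd z)))"
      by (auto simp: f_def fun_eq_iff split: split_indicator)
    then show ?thesis unfolding w_def by simp
  qed
  have g_pair: "case_prod g \<in> borel_measurable (lborel \<Otimes>\<^sub>M lborel)"
  proof -
    have "case_prod g = (\<lambda>z. indicator {0..} (snd z) *
        (indicator {z. p / q * snd z \<le> fst z} z * w (fst z) (snd z)))"
      by (auto simp: g_def fun_eq_iff split: split_indicator)
    then show ?thesis unfolding w_def by simp
  qed
  have sections: "f u \<in> borel_measurable lborel" "g u \<in> borel_measurable lborel" for u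
    using measurable_Pair2[OF f_pair, of u] measurable_Pair2[OF g_pair, of u] by simp_all
  have "cut_volume (insert i (insert j R)) x 1 1 =
      (\<integral>\<^sup>+u. indicator {0..} u * (\<integral>\<^sup>+v. indicator {0..} v * w u v \<partial>lborel) \<partial>lborel)"
    using R ij by (simp add: cut_volume_insert w_def)
  also have "\<dots> = (\<integral>\<^sup>+u. \<integral>\<^sup>+v. indicator {0..} u * (indicator {0..} v * w u v) \<partial>lborel \<partial>lborel)"
    by (intro nn_integral_cong nn_integral_cmult[symmetric]) measurable
  also have "\<dots> \<le> (\<integral>\<^sup>+u. \<integral>\<^sup>+v. f u v + g u v \<partial>lborel \<partial>lborel)"
    using p unfolding f_def g_def
    by (intro nn_integral_mono) (auto split: split_indicator simp: field_simps)
  also have "\<dots> = (\<integral>\<^sup>+u. (\<integral>\<^sup>+v. f u v \<partial>lborel) + (\<integral>\<^sup>+v. g u v \<partial>lborel) \<partial>lborel)"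
    by (intro nn_integral_cong nn_integral_add sections)
  also have "\<dots> = (\<integral>\<^sup>+u. \<integral>\<^sup>+v. f u v \<partial>lborel \<partial>lborel) + (\<integral>\<^sup>+u. \<integral>\<^sup>+v. g u v \<partial>lborel \<partial>lborel)"
    by (intro nn_integral_add lborel.borel_measurable_nn_integral f_pair g_pair)
  also have "(\<integral>\<^sup>+u. \<integral>\<^sup>+v. f u v \<partial>lborel \<partial>lborel) =
      ennreal (p / (real (card R) + 2)) * cut_volume (insert j R) x 1 1"
  proof -
    have "(\<integral>\<^sup>+u. \<integral>\<^sup>+v. f u v \<partial>lborel \<partial>lborel) =
        (\<integral>\<^sup>+u. indicator {0..} u * (\<integral>\<^sup>+v. indicator {q / p * u..} v * w u v \<partial>lborel) \<partial>lborel)"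
      unfolding f_def by (intro nn_integral_cong nn_integral_cmult) measurable
    then show ?thesis
      unfolding w_def using nn_integral_wedge[of R j p q x i] R ij p by simp
  qed
  also have "(\<integral>\<^sup>+u. \<integral>\<^sup>+v. g u v \<partial>lborel \<partial>lborel) =
      ennreal (q / (real (card R) + 2)) * cut_volume (insert i R) x 1 1"
  proof -
    have "(\<integral>\<^sup>+u. \<integral>\<^sup>+v. g u v \<partial>lborel \<partial>lborel) = (\<integral>\<^sup>+v. \<integral>\<^sup>+u. g u v \<partial>lborel \<partial>lborel)"
      using lborel_pair.Fubini'[OF g_pair] by simp
    also have "\<dots> = (\<integral>\<^sup>+v. indicator {0..} v * (\<integral>\<^sup>+u. indicator {p / q * v..} u * w u v \<partial>lborel) \<partial>lborel)"
      unfolding g_def by (intro nn_integral_cong nn_integral_cmult) measurable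
    finally have "(\<integral>\<^sup>+u. \<integral>\<^sup>+v. g u v \<partial>lborel \<partial>lborel) =
        (\<integral>\<^sup>+v. indicator {0..} v * (\<integral>\<^sup>+u. indicator {p / q * v..} u * w u v \<partial>lborel) \<partial>lborel)" .
    moreover have "w u v = cut_volume R x (1 - v - u) (1 - x j * v - x i * u)" for u v
      by (simp add: w_def algebra_simps)
    ultimately show ?thesis
      using nn_integral_wedge[of R i q p x j] R ij p by (simp add: add.commute)
  qed
  finally show ?thesis .
qed

text \<open>
  If one of the two bounds implies the other, the slice at \<open>t\<close> can be compared with one whose bounds agree,
  and the cut simplex is then contained in a cone over the facet belonging to \<open>I\<close>.
\<close>

lemma cut_volume_one_cone:
  fixes x :: "'i \<Rightarrow> real"
  assumes I: "finite I" and m: "m \<notin> I" and c: "0 < c"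
    and le: "\<And>t. 0 \<le> t \<Longrightarrow> cut_volume I x (1 - t) (1 - x m * t) \<le> cut_volume I x (1 - c * t) (1 - c * t)"
  shows "cut_volume (insert m I) x 1 1 \<le> ennreal (1 / (c * (real (card I) + 1))) * cut_volume I x 1 1"
proof -
  have "cut_volume (insert m I) x 1 1 \<le> (\<integral>\<^sup>+t. indicator {0..} t * cut_volume I x (1 - c * t) (1 - c * t) \<partial>lborel)"
    unfolding cut_volume_insert[OF I m]
    by (intro nn_integral_mono) (auto simp: le split: split_indicator)
  then show ?thesis by (simp only: nn_integral_cone[OF I c])
qed

section \<open>Bounding by deletions of one entry\<close>

text \<open>
  The factor \<open>fact (card I)\<close> makes this the probability that a uniform random point of the simplex over \<open>I\<close>
  satisfies the linear constraint.
\<close>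

definition cut_prob :: "'i set \<Rightarrow> ('i \<Rightarrow> real) \<Rightarrow> real" where
  "cut_prob I x = fact (card I) * enn2real (cut_volume I x 1 1)"

lemma cut_volume_le: "finite I \<Longrightarrow> cut_volume I x 1 1 \<le> ennreal (1 / fact (card I))"
proof -
  assume I: "finite I"
  let ?S = "{d. (\<forall>i\<in>I. 0 \<le> d i) \<and> sum d I \<le> 1} \<inter> space (\<Pi>\<^sub>M i\<in>I. lborel :: real measure)"
  have S: "?S = {d \<in> space (\<Pi>\<^sub>M i\<in>I. lborel). (\<forall>i\<in>I. 0 \<le> d i) \<and> sum d I \<le> 1}" by auto
  note I[measurable]
  have "?S \<in> sets (\<Pi>\<^sub>M i\<in>I. lborel)"
    unfolding S by measurable
  then have "cut_volume I x 1 1 \<le> emeasure (\<Pi>\<^sub>M i\<in>I. lborel) ?S"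
    unfolding cut_volume_def
    by (rule emeasure_mono[rotated]) (auto simp: cut_simplex_def)
  also have "\<dots> = ennreal (1 / fact (card I))"
    using emeasure_std_simplex_aux[of I 1] I by simp
  finally show ?thesis .
qed

lemma cut_volume_eq_cut_prob:
  "finite I \<Longrightarrow> cut_volume I x 1 1 = ennreal (cut_prob I x / fact (card I))"
  using le_less_trans[OF cut_volume_le[of I x] ennreal_less_top] by (simp add: cut_prob_def)

lemma cut_prob_nonneg: "0 \<le> cut_prob I x"
  by (simp add: cut_prob_def)

lemma cut_prob_empty: "cut_prob {} x = 1"
  by (simp add: cut_prob_def cut_volume_empty)

lemma cut_prob_one_deletion:
  fixes x :: "'i \<Rightarrow> real"
  assumes I: "finite I" and m: "m \<in> I" and c: "0 < c"
    and sub: "\<And>t. 0 \<le> t \<Longrightarrow>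
      cut_simplex (I - {m}) x (1 - t) (1 - x m * t) \<subseteq> cut_simplex (I - {m}) x (1 - c * t) (1 - c * t)"
  shows "cut_prob I x \<le> 1 / c * cut_prob (I - {m}) x"
proof -
  let ?J = "I - {m}"
  have J: "finite ?J" "m \<notin> ?J" "insert m ?J = I" using I m by auto
  have card: "card I = Suc (card ?J)" using card.insert_remove[of I m] I J(3) by simp
  have "cut_volume (insert m ?J) x 1 1 \<le> ennreal (1 / (c * (real (card ?J) + 1))) * cut_volume ?J x 1 1"
    using J(1,2) c
  proof (rule cut_volume_one_cone)
    fix t :: real assume "0 \<le> t"
    then show "cut_volume ?J x (1 - t) (1 - x m * t) \<le> cut_volume ?J x (1 - c * t) (1 - c * t)"
      unfolding cut_volume_def by (intro emeasure_mono sub cut_simplex_sets J(1))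
  qed
  then have "ennreal (cut_prob I x / fact (card I)) \<le>
      ennreal (1 / (c * (real (card ?J) + 1)) * (cut_prob ?J x / fact (card ?J)))"
    using c cut_prob_nonneg[of ?J x]
    unfolding J(3) cut_volume_eq_cut_prob[OF I] cut_volume_eq_cut_prob[OF J(1)]
    by (subst ennreal_mult) auto
  then have "cut_prob I x / fact (card I) \<le> 1 / (c * (real (card ?J) + 1)) * (cut_prob ?J x / fact (card ?J))"
    using c cut_prob_nonneg[of ?J x] by (subst (asm) ennreal_le_iff) auto
  also have "\<dots> = 1 / c * cut_prob ?J x / fact (card I)"
    using c by (simp add: card divide_simps)
  finally show ?thesis by (simp only: divide_le_cancel) simp
qed

lemma cut_prob_two_deletions:
  fixes x :: "'i \<Rightarrow> real"
  assumes I: "finite I" and ij: "i \<in> I" "j \<in> I" "i \<noteq> j"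
    and p: "0 < p" "0 < q" "p + q = 1" "p * x i + q * x j = 1"
  shows "cut_prob I x \<le> p * cut_prob (I - {i}) x + q * cut_prob (I - {j}) x"
proof -
  let ?R = "I - {i, j}"
  have R: "finite ?R" "i \<notin> ?R" "j \<notin> ?R" using I by auto
  have ins: "insert j ?R = I - {i}" "insert i ?R = I - {j}" "insert i (insert j ?R) = I"
    using ij by auto
  have card: "card (I - {i}) = Suc (card ?R)" "card (I - {j}) = Suc (card ?R)"
    using card_insert_disjoint[OF R(1,3)] card_insert_disjoint[OF R(1,2)] unfolding ins by auto
  have cardI: "card I = Suc (Suc (card ?R))"
    using card.remove[OF I ij(1)] card by simp
  have fin: "finite (I - {i})" "finite (I - {j})" using I by auto
  have "ennreal (cut_prob I x / fact (card I)) \<le>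
      ennreal (p / (real (card ?R) + 2) * (cut_prob (I - {i}) x / fact (card (I - {i}))) +
        q / (real (card ?R) + 2) * (cut_prob (I - {j}) x / fact (card (I - {j}))))"
    using cut_volume_two_cones[OF R ij(3) p] p cut_prob_nonneg[of "I - {i}" x] cut_prob_nonneg[of "I - {j}" x]
    unfolding ins(3) unfolding ins(1,2) cut_volume_eq_cut_prob[OF I] cut_volume_eq_cut_prob[OF fin(1)] cut_volume_eq_cut_prob[OF fin(2)]
    by (subst ennreal_plus) (auto simp: ennreal_mult[symmetric])
  then have "cut_prob I x / fact (card I) \<le>
      p / (real (card ?R) + 2) * (cut_prob (I - {i}) x / fact (card (I - {i}))) +
        q / (real (card ?R) + 2) * (cut_prob (I - {j}) x / fact (card (I - {j})))"
    using p cut_prob_nonneg[of "I - {i}" x] cut_prob_nonneg[of "I - {j}" x]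
    by (subst (asm) ennreal_le_iff) (auto intro!: add_nonneg_nonneg)
  also have "\<dots> = (p * cut_prob (I - {i}) x + q * cut_prob (I - {j}) x) / fact (card I)"
    by (simp add: card cardI add_divide_distrib algebra_simps)
  finally show ?thesis by (simp add: divide_le_cancel)
qed

text \<open>
  The weights are the barycentric coordinates of the apex.  Both bounds on their sums are what the
  induction for the elementary symmetric polynomials consumes.
\<close>

lemma cut_prob_le_deletions:
  fixes x :: "'i \<Rightarrow> real"
  assumes I: "finite I" "I \<noteq> {}" and x: "\<And>i. i \<in> I \<Longrightarrow> 0 \<le> x i"
  obtains p where "\<And>i. i \<in> I \<Longrightarrow> 0 \<le> p i" "(\<Sum>i\<in>I. p i) \<le> 1" "(\<Sum>i\<in>I. p i * x i) \<le> 1"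
    "cut_prob I x \<le> (\<Sum>i\<in>I. p i * cut_prob (I - {i}) x)"
proof -
  consider i j where "i \<in> I" "j \<in> I" "1 < x i" "x j < 1"
    | "\<And>i. i \<in> I \<Longrightarrow> 1 \<le> x i" | "\<And>i. i \<in> I \<Longrightarrow> x i \<le> 1"
    by (meson not_le)
  then show thesis
  proof cases
    case 1
    \<comment> \<open>The solution of \<open>p + q = 1\<close> and \<open>p * x i + q * x j = 1\<close>.\<close>
    define p where "p = (1 - x j) / (x i - x j)"
    define q where "q = (x i - 1) / (x i - x j)"
    have ij: "i \<noteq> j" and pos: "0 < p" "0 < q" using 1 by (auto simp: p_def q_def)
    have sum_p: "p + q = 1"
      using 1 by (simp add: p_def q_def flip: add_divide_distrib)
    have "p * x i + q * x j = ((1 - x j) * x i + (x i - 1) * x j) / (x i - x j)"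
      by (simp add: p_def q_def add_divide_distrib)
    also have "(1 - x j) * x i + (x i - 1) * x j = x i - x j" by (simp add: algebra_simps)
    finally have sum_px: "p * x i + q * x j = 1" using 1 by simp
    define w where "w l = (if l = i then p else if l = j then q else 0)" for l
    have w: "(\<Sum>l\<in>I. w l * f l) = p * f i + q * f j" for f
    proof -
      have "(\<Sum>l\<in>I. w l * f l) = (\<Sum>l\<in>{i, j}. w l * f l)"
        using I 1 by (intro sum.mono_neutral_right) (auto simp: w_def)
      then show ?thesis using ij by (simp add: w_def)
    qed
    show thesis
    proof (rule that[of w])
      show "0 \<le> w l" for l using pos by (simp add: w_def)
      show "(\<Sum>l\<in>I. w l) \<le> 1" using w[of "\<lambda>_. 1"] sum_p by simp
      show "(\<Sum>l\<in>I. w l * x l) \<le> 1" using w[of x] sum_px by simp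
      show "cut_prob I x \<le> (\<Sum>l\<in>I. w l * cut_prob (I - {l}) x)"
        unfolding w using cut_prob_two_deletions[OF I(1) 1(1,2) ij pos sum_p sum_px] by simp
    qed
  next
    case 2
    \<comment> \<open>The constraint \<open>\<Sum> x\<^sub>i d\<^sub>i \<le> 1\<close> is the stronger one; the cone has its apex at \<open>1 / x m\<close> on the axis \<open>m\<close>.\<close>
    obtain m where m: "m \<in> I" using I by blast
    have xm: "1 \<le> x m" using 2 m by blast
    have "cut_prob I x \<le> 1 / x m * cut_prob (I - {m}) x"
    proof (rule cut_prob_one_deletion[OF I(1) m])
      fix t :: real
      have "(\<Sum>l\<in>I - {m}. d l) \<le> (\<Sum>l\<in>I - {m}. x l * d l)" if "\<forall>l\<in>I - {m}. 0 \<le> d l" for d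
        using that 2 mult_right_mono[of 1 "x l" "d l" for l] by (intro sum_mono) simp
      then show "cut_simplex (I - {m}) x (1 - t) (1 - x m * t) \<subseteq>
          cut_simplex (I - {m}) x (1 - x m * t) (1 - x m * t)"
        unfolding cut_simplex_def by (intro subsetI CollectI) (smt (verit) mem_Collect_eq)
    qed (use xm in simp)
    with m I xm show thesis
      by (intro that[of "\<lambda>l. if l = m then 1 / x m else 0"])
         (simp_all add: if_distrib[where f = "\<lambda>z. z * _"] cong: if_cong)
  next
    case 3
    \<comment> \<open>The constraint \<open>\<Sum> d\<^sub>i \<le> 1\<close> is the stronger one; the apex is the unit vector on the axis \<open>m\<close>.\<close>
    obtain m where m: "m \<in> I" using I by blast
    have xm: "x m \<le> 1" using 3 m by blast
    have "cut_prob I x \<le> 1 / 1 * cut_prob (I - {m}) x"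
    proof (rule cut_prob_one_deletion[OF I(1) m])
      fix t :: real
      have "(\<Sum>l\<in>I - {m}. x l * d l) \<le> (\<Sum>l\<in>I - {m}. d l)" if "\<forall>l\<in>I - {m}. 0 \<le> d l" for d
        using that 3 mult_right_mono[of "x l" 1 "d l" for l] by (intro sum_mono) simp
      then show "cut_simplex (I - {m}) x (1 - t) (1 - x m * t) \<subseteq>
          cut_simplex (I - {m}) x (1 - 1 * t) (1 - 1 * t)"
        unfolding cut_simplex_def mult_1 by (intro subsetI CollectI) (smt (verit) mem_Collect_eq)
    qed simp
    with m I xm show thesis
      by (intro that[of "\<lambda>l. if l = m then 1 else 0"])
         (simp_all add: if_distrib[where f = "\<lambda>z. z * _"] cong: if_cong)
  qed
qed

section \<open>Elementary symmetric polynomials\<close>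

definition esym :: "'i set \<Rightarrow> nat \<Rightarrow> ('i \<Rightarrow> real) \<Rightarrow> real" where
  "esym I k x = (\<Sum>S\<in>{S. S \<subseteq> I \<and> card S = k}. \<Prod>i\<in>S. x i)"

lemma esym_0: "finite I \<Longrightarrow> esym I 0 x = 1"
proof -
  assume "finite I"
  then have "{S. S \<subseteq> I \<and> card S = 0} = {{}}" by (auto dest: finite_subset)
  then show ?thesis by (simp add: esym_def)
qed

lemma esym_Suc:
  assumes I: "finite I" and i: "i \<in> I"
  shows "esym I (Suc k) x = esym (I - {i}) (Suc k) x + x i * esym (I - {i}) k x"
proof -
  let ?A = "\<lambda>k. {S. S \<subseteq> I - {i} \<and> card S = k}"
  have fin: "finite (?A k)" for k using I by simp
  have "{S. S \<subseteq> I \<and> card S = Suc k} = ?A (Suc k) \<union> insert i ` ?A k"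
  proof (intro equalityI subsetI)
    fix S assume S: "S \<in> {S. S \<subseteq> I \<and> card S = Suc k}"
    show "S \<in> ?A (Suc k) \<union> insert i ` ?A k"
    proof (cases "i \<in> S")
      case True
      with S have "S = insert i (S - {i})" "S - {i} \<in> ?A k" by auto
      then show ?thesis by blast
    qed (use S in auto)
  next
    fix S assume "S \<in> ?A (Suc k) \<union> insert i ` ?A k"
    then show "S \<in> {S. S \<subseteq> I \<and> card S = Suc k}"
    proof
      assume "S \<in> insert i ` ?A k"
      then obtain T where T: "S = insert i T" "T \<subseteq> I - {i}" "card T = k" by auto
      then have "finite T" "i \<notin> T" using I finite_subset by auto
      with T i show ?thesis by auto
    qed auto
  qed
  moreover have "?A (Suc k) \<inter> insert i ` ?A k = {}" by auto
  moreover have "inj_on (insert i) (?A k)"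
    by (rule inj_onI) (auto dest: insert_ident[THEN iffD1, rotated -1])
  moreover have "(\<Prod>l\<in>insert i T. x l) = x i * (\<Prod>l\<in>T. x l)" if "T \<in> ?A k" for T
    using that I finite_subset[of T "I - {i}"] by (subst prod.insert) auto
  ultimately show ?thesis
    using fin by (simp add: esym_def sum.union_disjoint sum.reindex sum_distrib_left)
qed

text \<open>
  In the average over the deletions, the coefficients of \<open>n choose Suc r\<close> and \<open>n choose r\<close> are
  \<open>\<Sum> p\<^sub>i\<close> and \<open>\<Sum> p\<^sub>i x\<^sub>i\<close>, both at most one, so Pascal's rule closes the induction.
\<close>

lemma cut_prob_esym_le:
  fixes x :: "'i \<Rightarrow> real"
  assumes "finite I" and "\<And>i. i \<in> I \<Longrightarrow> 0 \<le> x i"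
  shows "cut_prob I x * esym I k x \<le> real (card I choose k)"
  using assms
proof (induction "card I" arbitrary: I k)
  case 0
  then have "I = {}" by simp
  then show ?case
    by (cases k) (simp_all add: cut_prob_empty esym_0, simp add: esym_def)
next
  case (Suc n)
  have I: "finite I" "I \<noteq> {}" using Suc.hyps(2) Suc.prems by auto
  obtain p where p: "\<And>i. i \<in> I \<Longrightarrow> 0 \<le> p i" "(\<Sum>i\<in>I. p i) \<le> 1" "(\<Sum>i\<in>I. p i * x i) \<le> 1"
    "cut_prob I x \<le> (\<Sum>i\<in>I. p i * cut_prob (I - {i}) x)"
    by (rule cut_prob_le_deletions[OF I Suc.prems(2)]) (assumption | rule that)+
  have card: "card (I - {i}) = n" if "i \<in> I" for i
    using that Suc.hyps(2) Suc.prems(1) by simp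
  have IH: "cut_prob (I - {i}) x * esym (I - {i}) k x \<le> real (n choose k)" if "i \<in> I" for i k
    using Suc.hyps(1)[of "I - {i}" k] card[OF that] Suc.prems by simp
  show ?case
  proof (cases k)
    case 0
    have "cut_prob I x \<le> (\<Sum>i\<in>I. p i * 1)"
      using IH[of _ 0] p(1) I(1)
      by (intro order_trans[OF p(4)] sum_mono mult_left_mono) (auto simp: esym_0)
    with p(2) 0 I(1) show ?thesis by (simp add: esym_0)
  next
    case (Suc r)
    let ?K = "\<lambda>i. cut_prob (I - {i}) x"
    have "0 \<le> esym I k x"
      unfolding esym_def using Suc.prems(2) by (intro sum_nonneg prod_nonneg) auto
    then have "cut_prob I x * esym I k x \<le> (\<Sum>i\<in>I. p i * ?K i) * esym I k x"
      using p(4) by (rule mult_right_mono[rotated])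
    also have "\<dots> = (\<Sum>i\<in>I. p i * (?K i * esym (I - {i}) (Suc r) x + x i * (?K i * esym (I - {i}) r x)))"
      unfolding sum_distrib_right Suc
      by (intro sum.cong refl) (subst esym_Suc[OF I(1)], auto simp: algebra_simps)
    also have "\<dots> \<le> (\<Sum>i\<in>I. p i * (real (n choose Suc r) + x i * real (n choose r)))"
      using IH p(1) Suc.prems(2) by (intro sum_mono mult_left_mono add_mono) auto
    also have "\<dots> = (\<Sum>i\<in>I. p i) * real (n choose Suc r) + (\<Sum>i\<in>I. p i * x i) * real (n choose r)"
      by (simp add: sum_distrib_right sum.distrib distrib_left mult.assoc)
    also have "\<dots> \<le> 1 * real (n choose Suc r) + 1 * real (n choose r)"
      using p(2,3) by (intro add_mono mult_right_mono) auto
    also have "\<dots> = real (card I choose k)"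
      by (simp add: Suc flip: Suc.hyps(2))
    finally show ?thesis .
  qed
qed

section \<open>The Dirichlet distribution\<close>

text \<open>
  \<open>K\<close> measures the open simplex and \<open>cut_prob\<close> the closed one, which contains it; the inequality suffices for an
  upper bound.
\<close>

lemma K_le_cut_prob: "K n x \<le> cut_prob {1..n} x"
proof (cases "n = 0")
  case True
  then show ?thesis by (simp add: K_def cut_prob_empty)
next
  case False
  let ?M = "\<Pi>\<^sub>M i\<in>{1..n}. lborel :: real measure"
  let ?U = "uniform_measure ?M (open_simplex n)"
  let ?N = "\<Pi>\<^sub>M i\<in>{0..n}. (borel :: real measure)"
  let ?h = "\<lambda>d. \<lambda>i\<in>{0..n}. if i = 0 then 1 - (\<Sum>j=1..n. d j) else d i :: real"
  let ?E = "{D \<in> space ?N. (\<Sum>i=1..n. x i * D i) \<le> 1}"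
  have E: "?E \<in> sets ?N" by measurable
  have hm: "?h \<in> ?U \<rightarrow>\<^sub>M ?N"
    by (subst measurable_cong_sets[OF sets_uniform_measure refl]) (rule dirichlet_map_measurable)
  let ?A = "?h -` ?E \<inter> space ?U"
  have A: "?A \<in> sets ?M" using measurable_sets[OF hm E] by simp
  have sub: "open_simplex n \<inter> ?A \<subseteq> cut_simplex {1..n} x 1 1"
  proof
    fix d assume d: "d \<in> open_simplex n \<inter> ?A"
    have "(\<Sum>i=1..n. x i * ?h d i) = (\<Sum>i=1..n. x i * d i)"
      by (intro sum.cong) auto
    moreover have "(\<Sum>i=1..n. x i * ?h d i) \<le> 1" using d by blast
    ultimately show "d \<in> cut_simplex {1..n} x 1 1"
      using d by (simp add: open_simplex_def cut_simplex_def space_PiM less_imp_le)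
  qed
  have "K n x = measure ?U ?A"
    using False hm E by (simp add: K_def dirichlet_one_eq_uniform measure_distr del: One_nat_def)
  also have "\<dots> = measure ?M (open_simplex n \<inter> ?A) / measure ?M (open_simplex n)"
    using A by (intro measure_uniform_measure) (auto simp: emeasure_open_simplex simp del: One_nat_def)
  also have "\<dots> = fact n * measure ?M (open_simplex n \<inter> ?A)"
    by (simp add: measure_def emeasure_open_simplex del: One_nat_def)
  also have "\<dots> \<le> cut_prob {1..n} x"
  proof -
    have "measure ?M (open_simplex n \<inter> ?A) \<le> measure ?M (cut_simplex {1..n} x 1 1)"
    proof (rule measure_mono_fmeasurable[OF sub])
      show "cut_simplex {1..n} x 1 1 \<in> fmeasurable ?M"
        using le_less_trans[OF cut_volume_le[of "{1..n}" x] ennreal_less_top]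
        by (intro fmeasurableI) (auto simp: cut_volume_def)
      show "open_simplex n \<inter> ?A \<in> sets ?M"
        by (rule sets.Int[OF open_simplex_sets A])
    qed
    then show ?thesis by (simp add: cut_prob_def cut_volume_def measure_def)
  qed
  finally show ?thesis .
qed

theorem theorem2p2:
  fixes n k :: nat and x :: "nat \<Rightarrow> real"
  assumes "\<And>i. i \<in> {1..n} \<Longrightarrow> 0 \<le> x i"
    and "k \<le> n"
  shows "K n x * elem_sym n k x \<le> real (n choose k) \<and> K n x * elem_sym_mean n k x \<le> 1"
proof -
  have e: "elem_sym n k x = esym {1..n} k x"
    by (simp add: elem_sym_def esym_def)
  have "0 \<le> elem_sym n k x"
    unfolding elem_sym_def using assms(1) by (intro sum_nonneg prod_nonneg) auto
  then have "K n x * elem_sym n k x \<le> cut_prob {1..n} x * elem_sym n k x"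
    by (intro mult_right_mono K_le_cut_prob)
  also have "\<dots> \<le> real (n choose k)"
    using cut_prob_esym_le[of "{1..n}" x k] assms(1) by (simp add: e)
  finally have le: "K n x * elem_sym n k x \<le> real (n choose k)" .
  moreover have "0 < real (n choose k)"
    using assms(2) by simp
  ultimately show ?thesis by (simp add: elem_sym_mean_def)
qed

end
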